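(* Let $n\ge p$ be positive integers, let $\bar X\in\mathbb{R}^{n\times p}$ with $r:=\operatorname{rank}\bar X$, and let $(\bar U,\bar V)\in O(n)\times O(p)$ be such that $\bar U\operatorname{diag}(\sigma(\bar X))\bar V^T=\bar X$. Then the following hold: (a) $\partial\|\cdot\|_*(\bar X)=\bar U\left\{\begin{pmatrix}I_r&0\\0&R\end{pmatrix}: R\in\mathbb{R}^{(n-r)\times(p-r)},\ \|R\|_{op}\le 1\right\}\bar V^T$; (b) $\operatorname{ri}(\partial\|\cdot\|_*(\bar X))=\bar U\left\{\begin{pmatrix}I_r&0\\0&R\end{pmatrix}: R\in\mathbb{R}^{(n-r)\times(p-r)},\ \|R\|_{op}<1\right\}\bar V^T$; (c) $\operatorname{par}(\partial\|\cdot\|_*(\bar X))=\bar U\left\{\begin{pmatrix}0&0\\0&R\end{pmatrix}: R\in\mathbb{R}^{(n-r)\times(p-r)}\right\}\bar V^T$.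
   Context: $\mathbb{R}^{n\times p}$ carries the inner product $\langle X,Y\rangle=\operatorname{tr}(X^TY)$. $\|\cdot\|_*$ is the nuclear norm (sum of singular values) and $\|\cdot\|_{op}$ the operator (spectral) norm (largest singular value; $0$ for an empty matrix, so that void blocks are allowed when $r=0$ or $r=p$). $\sigma(\bar X)\in\mathbb{R}^p$ is the vector of singular values in nonincreasing order, $\operatorname{diag}(\sigma(\bar X))$ is the $n\times p$ rectangular diagonal matrix with these diagonal entries, and $O(k)$ is the set of orthogonal $k\times k$ matrices. $\partial f(\bar X)=\{Y: f(\bar X)+\langle Y,X-\bar X\rangle\le f(X)\ \forall X\}$ is the convex subdifferential. For a nonempty convex set $C$, $\operatorname{ri}C$ is its relative interior (interior relative to the affine hull $\operatorname{aff}C$) and $\operatorname{par}C=\operatorname{aff}C-x$ (any $x\in C$) is the subspace parallel to $C$. For a set $\mathcal{M}$ of $n\times p$ matrices, $\bar U\mathcal{M}\bar V^T=\{\bar UB\bar V^T:B\in\mathcal{M}\}$. *)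

theory Defs
  imports "Jordan_Normal_Form.Char_Poly" "HOL-Analysis.Analysis"
begin

text \<open>
  The space of $n \times p$ matrices is the Euclidean space \<open>real^'p^'n\<close>, so that the inner product,
  affine hulls and relative interiors are those of HOL-Analysis.  Matrices whose sizes depend
  on a number (blocks, rectangular diagonal matrices) are of type \<open>real mat\<close>.  The index types
  are linearly ordered, and the order identifies them with \<open>{0..<CARD('n)}\<close>.
\<close>

definition index_pos :: "'n::{finite,linorder} \<Rightarrow> nat" where
  "index_pos i = card {j. j < i}"

definition index_at :: "nat \<Rightarrow> 'n::{finite,linorder}" where
  "index_at k = sorted_list_of_set UNIV ! k"

definition of_mat :: "real mat \<Rightarrow> real^('p::{finite,linorder})^('n::{finite,linorder})" where
  "of_mat A = (\<chi> i j. A $$ (index_pos i, index_pos j))"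

definition to_mat :: "real^('p::{finite,linorder})^('n::{finite,linorder}) \<Rightarrow> real mat" where
  "to_mat X = Matrix.mat CARD('n) CARD('p)
     (\<lambda>(i, j). vec_nth (vec_nth X (index_at i)) (index_at j))"

lemma index_at_pos: "index_at (index_pos i) = (i :: 'n::{finite,linorder})"
  and index_pos_less: "index_pos i < CARD('n)"
proof -
  let ?xs = "sorted_list_of_set (UNIV :: 'n set)"
  have xs: "set ?xs = UNIV" "length ?xs = CARD('n)" "sorted_wrt (<) ?xs"
    by (simp_all add: strict_sorted_list_of_set)
  obtain k where k: "k < length ?xs" "?xs ! k = i"
    using xs(1) by (metis UNIV_I in_set_conv_nth)
  have "{j. j < i} = (!) ?xs ` {..<k}"
  proof (intro Set.set_eqI iffI)
    fix j assume "j \<in> {j. j < i}"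
    moreover obtain l where l: "l < length ?xs" "?xs ! l = j"
      using xs(1) by (metis UNIV_I in_set_conv_nth)
    ultimately have "l < k"
      using xs(3) k by (metis leD linorder_le_less_linear mem_Collect_eq order_less_imp_le
          sorted_wrt_nth_less le_neq_implies_less)
    then show "j \<in> (!) ?xs ` {..<k}" using l by auto
  next
    fix j assume "j \<in> (!) ?xs ` {..<k}"
    then show "j \<in> {j. j < i}"
      using k xs(3) sorted_wrt_nth_less[of "(<)" ?xs] by fastforce
  qed
  moreover have "inj_on ((!) ?xs) {..<k}"
    using k by (intro inj_on_nth) auto
  ultimately have "index_pos i = k"
    by (simp add: index_pos_def card_image)
  then show "index_at (index_pos i) = i" "index_pos i < CARD('n)"
    using k xs(2) by (simp_all add: index_at_def)
qed

lemma index_pos_at: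
  assumes "k < CARD('n)"
  shows "index_pos (index_at k :: 'n::{finite,linorder}) = k"
proof -
  let ?i = "index_at k :: 'n"
  have "distinct (sorted_list_of_set (UNIV :: 'n set))" by simp
  moreover have "sorted_list_of_set (UNIV :: 'n set) ! index_pos ?i = sorted_list_of_set UNIV ! k"
    using index_at_pos[of ?i] by (simp add: index_at_def)
  ultimately show ?thesis
    using assms index_pos_less[of ?i] by (simp add: nth_eq_iff_index_eq)
qed

lemma of_mat_to_mat [simp]: "of_mat (to_mat X) = X"
  by (simp add: of_mat_def to_mat_def index_at_pos index_pos_less vec_eq_iff)

lemma to_mat_of_mat:
  assumes "A \<in> carrier_mat CARD('n) CARD('p)"
  shows "to_mat (of_mat A :: real^('p::{finite,linorder})^('n::{finite,linorder})) = A"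
  using assms by (intro eq_matI) (auto simp: of_mat_def to_mat_def index_pos_at)

lemma inner_matrix_eq_trace:
  fixes X Y :: "real^'p^'n"
  shows "inner X Y = trace (Finite_Cartesian_Product.transpose X ** Y)"
  unfolding trace_def matrix_matrix_mult_def Finite_Cartesian_Product.transpose_def inner_vec_def
  by (simp, rule sum.swap)

text \<open>
  Singular values in nonincreasing order with multiplicity: the square roots of the
  eigenvalues of $A^T A$.  The list has length \<open>dim_col A\<close>, which is the usual
  number of singular values when \<open>dim_col A \<le> dim_row A\<close>.
\<close>

definition singular_values :: "real mat \<Rightarrow> real list" where
  "singular_values A =
     rev (sorted_list_of_multiset (image_mset sqrt (proots (char_poly (transpose_mat A * A)))))"

definition op_norm :: "real mat \<Rightarrow> real" where
  "op_norm A = (if dim_row A = 0 \<or> dim_col A = 0 then 0 else Max (set (singular_values A)))"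

definition nuclear_norm :: "real^('p::{finite,linorder})^('n::{finite,linorder}) \<Rightarrow> real" where
  "nuclear_norm X = sum_list (singular_values (to_mat X))"

definition rect_diag :: "nat \<Rightarrow> nat \<Rightarrow> real list \<Rightarrow> real mat" where
  "rect_diag n p s = Matrix.mat n p (\<lambda>(i, j). if i = j then s ! i else 0)"

definition subdifferential :: "('a::real_inner \<Rightarrow> real) \<Rightarrow> 'a \<Rightarrow> 'a set" where
  "subdifferential f x = {y. \<forall>z. f x + inner y (z - x) \<le> f z}"

text \<open>The choice of base point is immaterial, see \<open>par_eq\<close>.\<close>

definition par :: "'a::real_vector set \<Rightarrow> 'a set" where
  "par C = (\<lambda>y. y - (SOME x. x \<in> C)) ` (affine hull C)"

lemma par_eq:
  assumes "x \<in> C"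
  shows "par C = (\<lambda>y. y - x) ` (affine hull C)"
proof -
  let ?H = "affine hull C"
  define w where "w = (SOME x. x \<in> C)"
  have w: "w \<in> C" unfolding w_def using assms by (rule someI)
  have sub: "(\<lambda>y. y - a) ` ?H \<subseteq> (\<lambda>y. y - b) ` ?H" if "a \<in> C" "b \<in> C" for a b
  proof
    fix z assume "z \<in> (\<lambda>y. y - a) ` ?H"
    then obtain y where y: "y \<in> ?H" "z = y - a" by auto
    have "y + 1 *\<^sub>R (b - a) \<in> ?H"
      using mem_affine_3_minus[OF affine_affine_hull y(1), of b a 1] that
      by (simp add: hull_inc)
    then show "z \<in> (\<lambda>y. y - b) ` ?H"
      using y(2) by (intro image_eqI[where x = "y + 1 *\<^sub>R (b - a)"]) auto
  qed
  show ?thesis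
    unfolding par_def w_def[symmetric] using sub[OF assms w] sub[OF w assms] by auto
qed

definition sandwich ::
    "real^'n^'n \<Rightarrow> (real^'p^'n) set \<Rightarrow> real^'p^'p \<Rightarrow> (real^'p^'n) set" where
  "sandwich U M V = {U ** B ** Finite_Cartesian_Product.transpose V | B. B \<in> M}"

end

theory Submission
  imports Defs
begin

text \<open>
  The spectral theorem gives $V$ orthogonal with $V^T Z^T Z V$ diagonal, so that
  $\|Z\|_* = \sum_j \|Z v_j\|$ for the columns $v_j$ of $V$; hence $\langle Y, Z\rangle \le \|Z\|_*$ for
  every contraction $Y$.  Conversely, a subgradient $Y$ at $\bar X = U D V^T$ is tested
  against $U D' V^T$ with modified diagonals, which forces $(U^T Y V)_{jj} = 1$ for $j \le r$ and
  $\langle Y, \bar X\rangle = \|\bar X\|_*$, and then against rank-one matrices, which shows that $Y$ is a contraction.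
  A contraction with a diagonal entry $1$ vanishes on the rest of that row and column; this is
  the block form.  Thus the subdifferential is a translated isometric copy of the operator-norm unit ball
  of a subspace, and its relative interior and affine hull are read off.
\<close>

section \<open>The spectral theorem\<close>

text \<open>Two kinds of matrices have to be reconciled. Singular values come from the
  characteristic polynomial of a \<open>real mat\<close>, whereas norms, hulls and interiors belong
  to \<open>real^'p^'n\<close>, and a block whose size depends on \<open>r\<close> has no type of
  the second kind. So \<open>R\<close> is handled through the full matrix that it becomes when
  padded with zeros: padding only adds zero singular values, hence keeps the operator norm, and the
  padded blocks form the coordinate subspace \<open>corner\<close>. The analysis refers to a set
  \<open>J\<close> of columns and an injection \<open>e\<close> that marks the diagonal; only at the
  end does the order of the singular values turn \<open>J\<close> into the first \<open>r\<close>
  positions. That there are at least as many rows as columns is what supplies \<open>e\<close>.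
  Rank-one test matrices have a computable nuclear norm because unit vectors can be completed to
  orthogonal matrices.\<close>

lemma self_adjoint_eigenvector:
  fixes f :: "'a::euclidean_space \<Rightarrow> 'a"
  assumes f: "linear f" and sym: "\<And>x y. inner (f x) y = inner x (f y)"
    and S: "subspace S" "f ` S \<subseteq> S" "S \<noteq> {0}"
  obtains v where "v \<in> S" "norm v = 1" "f v = inner v (f v) *\<^sub>R v"
proof -
  interpret f: linear f by (rule f)
  have cont: "continuous_on T f" for T
    using f linear_continuous_on linear_conv_bounded_linear by blast
  obtain w where w: "w \<in> S" "w \<noteq> 0"
    using S(1,3) subspace_0 by blast
  let ?K = "sphere 0 1 \<inter> S"
  have "(1 / norm w) *\<^sub>R w \<in> ?K"
    using w S(1) by (auto intro: subspace_scale)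
  moreover have "compact ?K"
    using S(1) by (intro compact_Int_closed closed_subspace) auto
  ultimately obtain v where v: "v \<in> ?K" and max: "\<And>x. x \<in> ?K \<Longrightarrow> inner x (f x) \<le> inner v (f v)"
    using continuous_attains_sup[of ?K "\<lambda>x. inner x (f x)"]
      continuous_on_inner[OF continuous_on_id cont] by blast
  define m where "m = inner v (f v)"
  have vS: "v \<in> S" and vv: "inner v v = 1"
    using v by (auto simp: dot_square_norm)
  have le: "inner x (f x) \<le> m * inner x x" if "x \<in> S" for x
  proof (cases "x = 0")
    case False
    then have "(1 / norm x) *\<^sub>R x \<in> ?K"
      using that S(1) by (auto intro: subspace_scale)
    from max[OF this] have "inner x (f x) / (norm x * norm x) \<le> m"
      by (simp add: m_def f.scale)
    then show ?thesis
      using False by (simp add: divide_simps dot_square_norm power2_eq_square split: if_splits)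
  qed (simp add: f.zero)
  \<comment> \<open>The Rayleigh quotient is maximal at \<open>v\<close>, so its derivative in the direction of the residual \<open>g\<close>, which is a
    multiple of $\|g\|^2$, vanishes.\<close>
  define g where "g = f v - m *\<^sub>R v"
  have gS: "g \<in> S"
    unfolding g_def using vS S by (intro subspace_diff subspace_scale) auto
  define a where "a = inner g g"
  define c where "c = m * inner g g - inner g (f g)"
  have ga: "inner g (f v) = a + m * inner g v"
    unfolding a_def by (subst (2) g_def) (simp add: inner_diff_right)
  have q: "0 \<le> t * t * c - 2 * t * a" for t
  proof -
    have "v + t *\<^sub>R g \<in> S"
      using vS gS S(1) by (intro subspace_add subspace_scale)
    moreover have "inner v (f g) = inner g (f v)"
      by (metis sym inner_commute)
    moreover have "inner v g = inner g v" by (rule inner_commute)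
    ultimately have "inner v (f v) + 2 * t * inner g (f v) + t * t * inner g (f g)
        \<le> m * (1 + 2 * t * inner g v + t * t * inner g g)"
      using le[of "v + t *\<^sub>R g"]
      by (simp add: f.add f.scale inner_add_left inner_add_right vv algebra_simps)
    then have "m + 2 * t * (a + m * inner g v) + t * t * inner g (f g)
        \<le> m * (1 + 2 * t * inner g v + t * t * inner g g)"
      by (simp add: m_def[symmetric] ga)
    then show ?thesis
      by (simp add: c_def algebra_simps)
  qed
  \<comment> \<open>A quadratic that is nonnegative for all \<open>t\<close> has no linear term: for
    \<open>c > 0\<close> the minimizer \<open>t = a / c\<close> gives the value
    \<open>- (a * a) / c\<close>; otherwise \<open>t = 1\<close> suffices, since \<open>a\<close> is
    nonnegative.\<close>
  have "a = 0"
  proof (cases "c \<le> 0")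
    case True
    then show ?thesis using q[of 1] inner_ge_zero[of g] unfolding a_def by linarith
  next
    case False
    then have "0 \<le> - (a * a) / c" using q[of "a / c"] by (simp add: field_simps)
    then have "a * a \<le> 0" using False by (simp add: zero_le_divide_iff field_simps)
    then show ?thesis by (metis mult_eq_0_iff zero_le_square order_antisym)
  qed
  then have "f v = m *\<^sub>R v" by (simp add: a_def g_def)
  then show thesis using that[of v] v by (simp add: m_def)
qed

text \<open>Induction on the dimension of \<open>S\<close>: by symmetry, the orthogonal complement
  within \<open>S\<close> of an eigenvector is invariant again. Invariant subspaces appear in the
  statement so that the induction can pass to this complement; the application takes
  \<open>S = UNIV\<close>.\<close>

lemma self_adjoint_eigenbasis:
  fixes f :: "'a::euclidean_space \<Rightarrow> 'a"
  assumes f: "linear f" and sym: "\<And>x y. inner (f x) y = inner x (f y)"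
    and S: "subspace S" "f ` S \<subseteq> S"
  obtains B where "B \<subseteq> S" "pairwise orthogonal B" "span B = S"
    "\<And>v. v \<in> B \<Longrightarrow> norm v = 1 \<and> (\<exists>d. f v = d *\<^sub>R v)"
proof -
  have "\<exists>B. B \<subseteq> S \<and> pairwise orthogonal B \<and> span B = S \<and> (\<forall>v\<in>B. norm v = 1 \<and> (\<exists>d. f v = d *\<^sub>R v))"
    using S
  proof (induction "dim S" arbitrary: S rule: less_induct)
    case less
    show ?case
    proof (cases "S = {0}")
      case True
      then show ?thesis by (intro exI[of _ "{}"]) auto
    next
      case False
      obtain v where v: "v \<in> S" "norm v = 1" "f v = inner v (f v) *\<^sub>R v"
        using self_adjoint_eigenvector[OF f sym less.prems False] by blast
      define T where "T = {x \<in> S. inner v x = 0}"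
      have T: "subspace T"
        using less.prems(1) by (auto simp: T_def subspace_def inner_add_right)
      have inv: "f ` T \<subseteq> T"
      proof (clarsimp simp: T_def, intro conjI)
        fix x assume x: "x \<in> S" "inner v x = 0"
        show "f x \<in> S" using x less.prems(2) by auto
        have "inner v (f x) = inner (f v) x" by (simp add: sym)
        also have "\<dots> = 0" by (subst v(3)) (simp add: x)
        finally show "inner v (f x) = 0" .
      qed
      have "v \<notin> T" using v(2) by (auto simp: T_def)
      moreover have "T \<subseteq> S" by (auto simp: T_def)
      ultimately have "T \<subset> S" using v(1) by blast
      then have "dim T < dim S"
        using T less.prems(1) by (metis dim_psubset span_eq_iff)
      from less.hyps[OF this T inv] obtain B where B: "B \<subseteq> T" "pairwise orthogonal B"
        "span B = T" "\<forall>v\<in>B. norm v = 1 \<and> (\<exists>d. f v = d *\<^sub>R v)"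
        by blast
      have "S \<subseteq> span (insert v B)"
      proof
        fix x assume x: "x \<in> S"
        have "x - inner v x *\<^sub>R v \<in> T"
          using x v(1,2) less.prems(1)
          by (auto simp: T_def inner_diff_right dot_square_norm intro: subspace_diff subspace_scale)
        then show "x \<in> span (insert v B)"
          using B(3) by (auto simp: span_breakdown_eq)
      qed
      moreover have "span (insert v B) \<subseteq> S"
        using v(1) B(1) less.prems(1) by (intro span_minimal) (auto simp: T_def)
      moreover have "pairwise orthogonal (insert v B)"
        using B(1,2) by (auto simp: pairwise_insert T_def orthogonal_def inner_commute)
      ultimately show ?thesis
        using v B by (intro exI[of _ "insert v B"]) (auto simp: T_def)
    qed
  qed
  then show thesis using that by blast
qed

no_notation vec_index (infixl "$" 100)

abbreviation (input) transp :: "'a^'n^'m \<Rightarrow> 'a^'m^'n" where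
  "transp \<equiv> Finite_Cartesian_Product.transpose"

text \<open>The map \<open>e\<close> sends a column to the row of its diagonal entry; square diagonal matrices have \<open>e = id\<close>.\<close>

definition gen_diag :: "('p \<Rightarrow> 'n) \<Rightarrow> ('p \<Rightarrow> real) \<Rightarrow> real^'p^'n" where
  "gen_diag e t = (\<chi> i j. if i = e j then t j else 0)"

text \<open>The unit eigenvectors become the columns of \<open>V\<close>: an independent spanning
  set has \<open>CARD('p)\<close> elements, so it can be indexed by \<open>'p\<close>.\<close>

lemma spectral_theorem:
  fixes A :: "real^'p^'p"
  assumes "transp A = A"
  obtains V d where "orthogonal_matrix V" "transp V ** A ** V = gen_diag id d"
proof -
  have sym: "inner (A *v x) y = inner x (A *v y)" for x y
    by (metis assms dot_lmul_matrix matrix_vector_mul_linear transpose_matrix_vector)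
  obtain B where B: "pairwise orthogonal B" "span B = UNIV"
     "\<And>v. v \<in> B \<Longrightarrow> norm v = 1 \<and> (\<exists>d. A *v v = d *\<^sub>R v)"
    using self_adjoint_eigenbasis[of "(*v) A" UNIV] sym by auto
  have "0 \<notin> B" using B(3) by force
  then have ind: "independent B" using B(1) pairwise_orthogonal_independent by blast
  then have "card B = CARD('p)"
    using B(2) by (metis dim_UNIV dim_span_eq_card_independent DIM_cart DIM_real mult.right_neutral)
  moreover have "finite B" using ind independent_imp_finite by blast
  ultimately obtain g where g: "bij_betw g (UNIV :: 'p set) B"
    using finite_same_card_bij[of "UNIV :: 'p set" B] by auto
  then have gB: "g j \<in> B" for j by (auto simp: bij_betw_def)
  obtain d where d: "A *v g j = d j *\<^sub>R g j" for j
    using B(3)[OF gB] by metis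
  define V :: "real^'p^'p" where "V = (\<chi> i j. g j $ i)"
  have col: "column j V = g j" for j by (simp add: V_def column_def vec_eq_iff)
  have ort: "inner (g i) (g j) = (if i = j then 1 else 0)" for i j
  proof (cases "i = j")
    case True
    then show ?thesis using B(3)[OF gB[of i]] by (simp add: dot_square_norm)
  next
    case False
    then have "g i \<noteq> g j" using g by (auto simp: bij_betw_def inj_def)
    then show ?thesis using False B(1) gB by (auto simp: pairwise_def orthogonal_def)
  qed
  have V: "orthogonal_matrix V"
    by (auto simp: orthogonal_matrix_orthonormal_columns col orthogonal_def ort norm_eq_1)
  have "(transp V ** A ** V) $ i $ j = gen_diag id d $ i $ j" for i j
  proof -
    have "(transp V ** A ** V) $ i $ j = inner (g i) (A *v g j)"
      unfolding matrix_mul_assoc[symmetric]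
      by (simp add: matrix_matrix_mult_def matrix_vector_mult_def
          inner_vec_def Finite_Cartesian_Product.transpose_def V_def)
    also have "\<dots> = gen_diag id d $ i $ j" by (simp add: d ort gen_diag_def)
    finally show ?thesis .
  qed
  then show thesis using V by (intro that[of V d]) (simp_all add: vec_eq_iff)
qed

section \<open>Singular values and the nuclear norm\<close>

lemma bij_betw_index_at: "bij_betw index_at {0..<CARD('n)} (UNIV :: 'n::{finite,linorder} set)"
  by (rule bij_betw_byWitness[where f' = index_pos])
     (auto simp: index_pos_at index_at_pos index_pos_less)

lemma index_pos_eq_iff [simp]: "index_pos i = index_pos j \<longleftrightarrow> i = j"
  by (metis index_at_pos)

lemma index_at_eq_iff:
  "i < CARD('n) \<Longrightarrow> j < CARD('n) \<Longrightarrow> index_at i = (index_at j :: 'n::{finite,linorder}) \<longleftrightarrow> i = j"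
  by (metis index_pos_at)

lemma to_mat_carrier [simp]:
  "to_mat (X :: real^('p::{finite,linorder})^('n::{finite,linorder})) \<in> carrier_mat CARD('n) CARD('p)"
  by (simp add: to_mat_def)

lemma to_mat_mult:
  fixes X :: "real^('m::{finite,linorder})^('n::{finite,linorder})" and Y :: "real^('p::{finite,linorder})^('m::{finite,linorder})"
  shows "to_mat (X ** Y) = to_mat X * to_mat Y"
proof (rule eq_matI)
  fix i j assume "i < dim_row (to_mat X * to_mat Y)" "j < dim_col (to_mat X * to_mat Y)"
  then have ij: "i < CARD('n)" "j < CARD('p)" by (simp_all add: to_mat_def)
  have "(to_mat X * to_mat Y) $$ (i, j) =
      (\<Sum>k\<in>{0..<CARD('m)}. X $ index_at i $ index_at k * Y $ index_at k $ index_at j)"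
    using ij by (simp add: to_mat_def scalar_prod_def)
  also have "\<dots> = (\<Sum>k\<in>UNIV. X $ index_at i $ k * Y $ k $ index_at j)"
    by (rule sum.reindex_bij_betw[OF bij_betw_index_at])
  finally show "to_mat (X ** Y) $$ (i, j) = (to_mat X * to_mat Y) $$ (i, j)"
    using ij by (simp add: to_mat_def matrix_matrix_mult_def)
qed (simp_all add: to_mat_def)

lemma to_mat_transpose: "to_mat (transp X) = transpose_mat (to_mat X)"
  by (rule eq_matI) (simp_all add: to_mat_def Finite_Cartesian_Product.transpose_def)

lemma to_mat_one: "to_mat (Finite_Cartesian_Product.mat 1 :: real^('n::{finite,linorder})^('n::{finite,linorder})) = 1\<^sub>m CARD('n::{finite,linorder})"
  by (rule eq_matI) (auto simp: to_mat_def Finite_Cartesian_Product.mat_def index_at_eq_iff)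

text \<open>A diagonal matrix is upper triangular, so its characteristic polynomial is a product of
  linear factors; the product over positions is then reindexed to one over
  \<open>'p\<close>.\<close>

lemma proots_char_poly_gen_diag:
  "proots (char_poly (to_mat (gen_diag id d))) = image_mset d (mset_set (UNIV :: 'p::{finite,linorder} set))"
proof -
  let ?D = "to_mat (gen_diag id d :: real^('p::{finite,linorder})^('p::{finite,linorder}))"
  have "upper_triangular ?D"
    by (auto simp: to_mat_def gen_diag_def index_at_eq_iff)
  then have "char_poly ?D = (\<Prod>a\<leftarrow>diag_mat ?D. [:- a, 1:])"
    using char_poly_upper_triangular[OF to_mat_carrier] by blast
  also have "\<dots> = (\<Prod>k\<leftarrow>[0..<CARD('p)]. [:- d (index_at k), 1:])"
    by (intro arg_cong[where f = prod_list])
       (simp add: diag_mat_def to_mat_def gen_diag_def cong: map_cong)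
  also have "\<dots> = (\<Prod>k\<in>{0..<CARD('p)}. [:- d (index_at k), 1:])"
    using prod.distinct_set_conv_list[of "[0..<CARD('p)]" "\<lambda>k. [:- d (index_at k), 1:]"] by simp
  also have "\<dots> = (\<Prod>j\<in>UNIV. [:- d j, 1:])"
    by (rule prod.reindex_bij_betw[OF bij_betw_index_at])
  finally have "proots (char_poly ?D) = (\<Sum>j\<in>UNIV. {#d j#})"
    by (simp add: proots_prod)
  also have "\<dots> = image_mset d (mset_set UNIV)"
    by (simp add: sum_unfold_sum_mset)
  finally show ?thesis .
qed

lemma proots_char_poly_similar_diag:
  fixes A V :: "real^('p::{finite,linorder})^('p::{finite,linorder})"
  assumes V: "orthogonal_matrix V" and A: "transp V ** A ** V = gen_diag id d"
  shows "proots (char_poly (to_mat A)) = image_mset d (mset_set UNIV)"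
proof -
  have VV: "transp V ** V = Finite_Cartesian_Product.mat 1" "V ** transp V = Finite_Cartesian_Product.mat 1"
    using V by (simp_all add: orthogonal_matrix_def)
  have "similar_mat_wit (to_mat (gen_diag id d :: real^('p::{finite,linorder})^('p::{finite,linorder}))) (to_mat A) (to_mat (transp V)) (to_mat V)"
    unfolding similar_mat_wit_def Let_def
    by (simp add: to_mat_mult[symmetric] VV to_mat_one A) (simp add: to_mat_def)
  then have "char_poly (to_mat (gen_diag id d :: real^('p::{finite,linorder})^('p::{finite,linorder}))) = char_poly (to_mat A)"
    by (intro char_poly_similar) (auto simp: similar_mat_def)
  then show ?thesis by (metis proots_char_poly_gen_diag)
qed

text \<open>The bridge from the characteristic polynomial to geometry: whenever an orthogonal
  \<open>V\<close> makes the columns of \<open>Z ** V\<close> pairwise orthogonal, their lengths are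
  the singular values.\<close>

lemma mset_singular_values:
  fixes Z :: "real^('p::{finite,linorder})^('n::{finite,linorder})"
  assumes "orthogonal_matrix V" and "transp (Z ** V) ** (Z ** V) = gen_diag id d"
  shows "mset (singular_values (to_mat Z)) = image_mset (\<lambda>j. sqrt (d j)) (mset_set UNIV)"
proof -
  have "transp V ** (transp Z ** Z) ** V = gen_diag id d"
    using assms(2) by (simp add: matrix_transpose_mul matrix_mul_assoc)
  from proots_char_poly_similar_diag[OF assms(1) this]
  show ?thesis
    by (simp add: singular_values_def to_mat_mult to_mat_transpose multiset.map_comp o_def)
qed

lemma nuclear_norm_eq:
  assumes "orthogonal_matrix V" and "transp (Z ** V) ** (Z ** V) = gen_diag id d"
  shows "nuclear_norm Z = (\<Sum>j\<in>UNIV. sqrt (d j))"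
  using arg_cong[OF mset_singular_values[OF assms], of sum_mset]
  by (simp add: nuclear_norm_def sum_mset_sum_list sum_unfold_sum_mset)

lemma transpose_mult_component:
  "(transp A ** B) $ i $ j = inner (column i A) (column j B)"
  for A :: "real^'p^'n" and B :: "real^'q^'n"
  by (simp add: matrix_matrix_mult_def Finite_Cartesian_Product.transpose_def inner_vec_def column_def)

lemma column_mult: "column j (A ** B) = A *v column j B" for A :: "real^'m^'n"
  by (simp add: vec_eq_iff column_def matrix_matrix_mult_def matrix_vector_mult_def)

text \<open>The columns of \<open>V\<close> are right singular vectors. The diagonal entries given
  by the spectral theorem can only be the squared lengths of the columns of
  \<open>Z ** V\<close>.\<close>

lemma singular_basis:
  fixes Z :: "real^'p^'n"
  obtains V where "orthogonal_matrix V"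
    "transp (Z ** V) ** (Z ** V) = gen_diag id (\<lambda>j. (norm (Z *v column j V))\<^sup>2)"
proof -
  have "transp (transp Z ** Z) = transp Z ** Z"
    by (simp add: matrix_transpose_mul)
  then obtain V d where V: "orthogonal_matrix V" and d: "transp V ** (transp Z ** Z) ** V = gen_diag id d"
    by (rule spectral_theorem)
  have d': "transp (Z ** V) ** (Z ** V) = gen_diag id d"
    using d by (simp add: matrix_transpose_mul matrix_mul_assoc)
  have "d j = (norm (Z *v column j V))\<^sup>2" for j
    using arg_cong[OF d', of "\<lambda>A. A $ j $ j"]
    by (simp add: transpose_mult_component column_mult gen_diag_def dot_square_norm)
  then show thesis using that[OF V] d' by presburger
qed

text \<open>Injectivity of \<open>e\<close> puts the entries of different columns into different
  rows, so the columns are orthogonal.\<close>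

lemma gen_diag_square:
  fixes e :: "'p::finite \<Rightarrow> 'n::finite"
  assumes "inj e"
  shows "transp (gen_diag e t) ** gen_diag e t = gen_diag id (\<lambda>j. (t j)\<^sup>2)"
proof -
  have "(\<Sum>k\<in>UNIV. (if k = e i then t i else 0) * (if k = e j then t j else 0)) =
     (if i = j then (t j)\<^sup>2 else 0)" for i j
  proof -
    have "(\<Sum>k\<in>UNIV. (if k = e i then t i else 0) * (if k = e j then t j else 0)) =
      (\<Sum>k\<in>UNIV. if k = e i then t i * (if e i = e j then t j else 0) else 0)"
      by (intro sum.cong) auto
    also have "\<dots> = (if i = j then (t j)\<^sup>2 else 0)"
      using assms by (simp add: inj_eq power2_eq_square)
    finally show ?thesis .
  qed
  then show ?thesis
    by (simp add: vec_eq_iff matrix_matrix_mult_def Finite_Cartesian_Product.transpose_def gen_diag_def)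
qed

lemma transp_orthogonal_mult:
  fixes U :: "real^'n^'n" and D :: "real^'p^'n"
  assumes "orthogonal_matrix U"
  shows "transp (U ** D) ** (U ** D) = transp D ** D"
proof -
  have "transp (U ** D) ** (U ** D) = transp D ** ((transp U ** U) ** D)"
    by (simp add: matrix_transpose_mul matrix_mul_assoc)
  then show ?thesis using assms by (simp add: orthogonal_matrix_def)
qed

text \<open>The columns of \<open>V\<close> are right singular vectors of this matrix. The entries
  \<open>t j\<close> may come in any order, so a diagonal can later be changed at a single
  place.\<close>

lemma nuclear_norm_gen_diag:
  fixes U :: "real^('n::{finite,linorder})^('n::{finite,linorder})" and V :: "real^('p::{finite,linorder})^('p::{finite,linorder})"
  assumes "orthogonal_matrix U" "orthogonal_matrix V" "inj e" "\<And>j. 0 \<le> t j"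
  shows "nuclear_norm (U ** gen_diag e t ** transp V) = (\<Sum>j\<in>UNIV. t j)"
proof -
  have "U ** gen_diag e t ** transp V ** V = U ** gen_diag e t"
    using assms(2) by (simp add: orthogonal_matrix_def matrix_mul_assoc[symmetric])
  then have "transp (U ** gen_diag e t ** transp V ** V) ** (U ** gen_diag e t ** transp V ** V)
      = gen_diag id (\<lambda>j. (t j)\<^sup>2)"
    by (simp add: transp_orthogonal_mult assms(1) gen_diag_square assms(3))
  from nuclear_norm_eq[OF assms(2) this] show ?thesis
    using assms(4) by simp
qed

lemma inner_matrix_columns:
  fixes A B :: "real^'p^'n"
  shows "inner A B = (\<Sum>j\<in>UNIV. inner (column j A) (column j B))"
  by (simp add: inner_vec_def column_def) (rule sum.swap)

lemma inner_orthogonal_left: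
  fixes A B :: "real^'p^'n"
  assumes "orthogonal_matrix U"
  shows "inner (U ** A) (U ** B) = inner A B"
proof -
  have "transp (U ** A) ** (U ** B) = transp A ** ((transp U ** U) ** B)"
    by (simp add: matrix_transpose_mul matrix_mul_assoc)
  then show ?thesis
    using assms by (simp add: inner_matrix_eq_trace orthogonal_matrix_def)
qed

lemma inner_transpose: "inner (transp A) (transp B) = inner A B" for A B :: "real^'p^'n"
  by (simp add: inner_vec_def Finite_Cartesian_Product.transpose_def) (rule sum.swap)

lemma inner_orthogonal_right:
  fixes A B :: "real^'p^'n"
  assumes "orthogonal_matrix V"
  shows "inner (A ** V) (B ** V) = inner A B"
  using inner_orthogonal_left[of "transp V" "transp A" "transp B"] assms
  by (simp add: matrix_transpose_mul[symmetric] inner_transpose)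

lemma norm_column_orthogonal: "orthogonal_matrix V \<Longrightarrow> norm (column j V) = 1" for V :: "real^'n^'n"
  by (simp add: orthogonal_matrix_orthonormal_columns)

lemma inner_le_nuclear_norm:
  fixes Y Z :: "real^('p::{finite,linorder})^('n::{finite,linorder})"
  assumes "\<And>x. norm (Y *v x) \<le> norm x"
  shows "inner Y Z \<le> nuclear_norm Z"
proof -
  obtain V where V: "orthogonal_matrix V"
    and d: "transp (Z ** V) ** (Z ** V) = gen_diag id (\<lambda>j. (norm (Z *v column j V))\<^sup>2)"
    by (rule singular_basis)
  have "inner Y Z = (\<Sum>j\<in>UNIV. inner (Y *v column j V) (Z *v column j V))"
    using inner_matrix_columns[of "Y ** V" "Z ** V"] by (simp add: inner_orthogonal_right[OF V] column_mult)
  also have "\<dots> \<le> (\<Sum>j\<in>UNIV. norm (Z *v column j V))"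
  proof (intro sum_mono)
    fix j
    have "inner (Y *v column j V) (Z *v column j V) \<le> norm (Y *v column j V) * norm (Z *v column j V)"
      by (rule norm_cauchy_schwarz)
    also have "\<dots> \<le> 1 * norm (Z *v column j V)"
      using assms[of "column j V"] by (intro mult_right_mono) (simp_all add: norm_column_orthogonal[OF V])
    finally show "inner (Y *v column j V) (Z *v column j V) \<le> norm (Z *v column j V)" by simp
  qed
  also have "\<dots> = nuclear_norm Z"
    using nuclear_norm_eq[OF V d] by simp
  finally show ?thesis .
qed

section \<open>The operator norm\<close>

lemma gen_diag_id_mult_vec: "(gen_diag id d *v c) $ j = d j * c $ j"
  by (simp add: gen_diag_def matrix_vector_mult_def if_distrib[where f = "\<lambda>x. x * _"] cong: if_cong)

lemma norm_orthogonal_mult: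
  fixes V :: "real^'n^'n"
  assumes "orthogonal_matrix V"
  shows "norm (V *v x) = norm x"
  using assms orthogonal_transformation_matrix[of "(*v) V"]
  by (simp add: orthogonal_transformation)

lemma onorm_matrix_le_iff:
  fixes A :: "real^'p^'n"
  assumes "0 \<le> c"
  shows "onorm ((*v) A) \<le> c \<longleftrightarrow> (\<forall>x. norm (A *v x) \<le> c * norm x)"
proof
  assume le: "onorm ((*v) A) \<le> c"
  show "\<forall>x. norm (A *v x) \<le> c * norm x"
  proof
    fix x
    have "norm (A *v x) \<le> onorm ((*v) A) * norm x"
      by (rule onorm) (rule matrix_vector_mul_bounded_linear)
    also have "\<dots> \<le> c * norm x" using le by (intro mult_right_mono) auto
    finally show "norm (A *v x) \<le> c * norm x" .
  qed
next
  assume "\<forall>x. norm (A *v x) \<le> c * norm x"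
  then show "onorm ((*v) A) \<le> c" using assms by (intro onorm_bound) auto
qed

lemma onorm_zero_matrix [simp]: "onorm ((*v) (0 :: real^'p^'n)) = 0"
  using onorm_zero by (simp add: matrix_vector_mult_0[abs_def])

text \<open>In the coordinates \<open>c\<close> of \<open>x\<close> with respect to the columns of
  \<open>V\<close>, the squared norm of \<open>Z *v x\<close> is the sum of the squares of
  \<open>c $ j\<close>, weighted by the squared norms of \<open>Z *v column j V\<close>. The bound
  is attained at a column of \<open>V\<close>.\<close>

lemma onorm_eq_Max_singular_basis:
  fixes Z :: "real^'p^'n"
  assumes V: "orthogonal_matrix V"
    and d: "transp (Z ** V) ** (Z ** V) = gen_diag id (\<lambda>j. (norm (Z *v column j V))\<^sup>2)"
  shows "onorm ((*v) Z) = Max (range (\<lambda>j. norm (Z *v column j V)))"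
proof (rule antisym)
  let ?m = "Max (range (\<lambda>j. norm (Z *v column j V)))"
  have m: "norm (Z *v column j V) \<le> ?m" for j by simp
  then have m0: "0 \<le> ?m" using norm_ge_zero order_trans by blast
  have "norm (Z *v x) \<le> ?m * norm x" for x
  proof -
    define c where "c = transp V *v x"
    have nc: "norm c = norm x"
      unfolding c_def using V by (intro norm_orthogonal_mult) simp
    have "V *v c = x"
      using V by (simp add: c_def matrix_vector_mul_assoc orthogonal_matrix_def del: transpose_matrix_vector)
    then have Zx: "Z *v x = (Z ** V) *v c" by (metis matrix_vector_mul_assoc)
    have "(norm (Z *v x))\<^sup>2 = inner c (transp (Z ** V) *v ((Z ** V) *v c))"
      by (simp add: Zx dot_square_norm[symmetric] dot_lmul_matrix[symmetric] transpose_matrix_vector)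
         (metis dot_lmul_matrix inner_commute)
    also have "\<dots> = inner c (gen_diag id (\<lambda>j. (norm (Z *v column j V))\<^sup>2) *v c)"
      by (simp add: matrix_vector_mul_assoc d)
    also have "\<dots> = (\<Sum>j\<in>UNIV. (norm (Z *v column j V))\<^sup>2 * (c $ j)\<^sup>2)"
      by (simp add: inner_vec_def gen_diag_id_mult_vec power2_eq_square ac_simps)
    also have "\<dots> \<le> (\<Sum>j\<in>UNIV. ?m\<^sup>2 * (c $ j)\<^sup>2)"
      by (intro sum_mono mult_right_mono power_mono m) auto
    also have "\<dots> = ?m\<^sup>2 * inner c c"
      by (simp add: inner_vec_def power2_eq_square sum_distrib_left)
    also have "\<dots> = (?m * norm x)\<^sup>2"
      by (simp add: dot_square_norm nc power_mult_distrib)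
    finally show ?thesis
      using m0 by (meson norm_ge_zero mult_nonneg_nonneg power2_le_imp_le)
  qed
  then show "onorm ((*v) Z) \<le> ?m" using m0 by (simp add: onorm_matrix_le_iff)
  have "norm (Z *v column j V) \<le> onorm ((*v) Z)" for j
    using onorm[OF matrix_vector_mul_bounded_linear, of Z "column j V"]
    by (simp add: norm_column_orthogonal[OF V])
  then show "?m \<le> onorm ((*v) Z)" by simp
qed

lemma singular_values_singular_basis:
  fixes Z :: "real^('p::{finite,linorder})^('n::{finite,linorder})"
  assumes V: "orthogonal_matrix V"
    and d: "transp (Z ** V) ** (Z ** V) = gen_diag id (\<lambda>j. (norm (Z *v column j V))\<^sup>2)"
  shows "mset (singular_values (to_mat Z)) = image_mset (\<lambda>j. norm (Z *v column j V)) (mset_set UNIV)"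
  using mset_singular_values[OF assms] by simp

lemma singular_values_nonneg:
  fixes Z :: "real^('p::{finite,linorder})^('n::{finite,linorder})"
  assumes "s \<in> set (singular_values (to_mat Z))"
  shows "0 \<le> s"
proof -
  obtain V where V: "orthogonal_matrix V"
    and d: "transp (Z ** V) ** (Z ** V) = gen_diag id (\<lambda>j. (norm (Z *v column j V))\<^sup>2)"
    by (rule singular_basis)
  show ?thesis
    using arg_cong[OF singular_values_singular_basis[OF V d], of set_mset] assms by auto
qed

lemma length_singular_values:
  fixes Z :: "real^('p::{finite,linorder})^('n::{finite,linorder})"
  shows "length (singular_values (to_mat Z)) = CARD('p)"
proof -
  obtain V where V: "orthogonal_matrix V"
    and d: "transp (Z ** V) ** (Z ** V) = gen_diag id (\<lambda>j. (norm (Z *v column j V))\<^sup>2)"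
    by (rule singular_basis)
  show ?thesis
    using arg_cong[OF singular_values_singular_basis[OF V d], of size] by simp
qed

lemma onorm_eq_Max_singular_values:
  fixes Z :: "real^('p::{finite,linorder})^('n::{finite,linorder})"
  shows "onorm ((*v) Z) = Max (set (singular_values (to_mat Z)))"
proof -
  obtain V where V: "orthogonal_matrix V"
    and d: "transp (Z ** V) ** (Z ** V) = gen_diag id (\<lambda>j. (norm (Z *v column j V))\<^sup>2)"
    by (rule singular_basis)
  show ?thesis
    using arg_cong[OF singular_values_singular_basis[OF V d], of set_mset]
    by (simp add: onorm_eq_Max_singular_basis[OF V d])
qed

section \<open>Singular values of a block padded with zeros\<close>

lemma char_poly_block_diag:
  fixes A B :: "'a::idom mat"
  assumes A: "A \<in> carrier_mat n n" and B: "B \<in> carrier_mat m m"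
  shows "char_poly (four_block_mat A (0\<^sub>m n m) (0\<^sub>m m n) B) = char_poly A * char_poly B"
proof -
  have "char_poly_matrix (four_block_mat A (0\<^sub>m n m) (0\<^sub>m m n) B) =
      four_block_mat (char_poly_matrix A) (0\<^sub>m n m) (0\<^sub>m m n) (char_poly_matrix B)"
    using A B by (intro eq_matI) (auto simp: char_poly_matrix_def)
  then show ?thesis
    unfolding char_poly_def
    by (simp, intro det_four_block_mat_lower_left_zero) (use A B in auto)
qed

text \<open>The Gram matrix of the padded matrix is block diagonal, with a zero block of size
  \<open>r\<close> and the Gram matrix of \<open>R\<close>.\<close>

lemma mset_singular_values_corner:
  assumes R: "R \<in> carrier_mat (n - r) (p - r)" and rp: "r \<le> p" "r \<le> n"
  shows "mset (singular_values (four_block_mat (0\<^sub>m r r) (0\<^sub>m r (p - r)) (0\<^sub>m (n - r) r) R)) =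
    replicate_mset r 0 + mset (singular_values R)"
proof -
  let ?M = "four_block_mat (0\<^sub>m r r) (0\<^sub>m r (p - r)) (0\<^sub>m (n - r) r) R"
  have "transpose_mat ?M = four_block_mat (0\<^sub>m r r) (0\<^sub>m r (n - r)) (0\<^sub>m (p - r) r) (transpose_mat R)"
    by (subst transpose_four_block_mat[OF _ _ _ R]) auto
  then have "transpose_mat ?M * ?M =
      four_block_mat (0\<^sub>m r r) (0\<^sub>m r (p - r)) (0\<^sub>m (p - r) r) (transpose_mat R * R)"
    using R by (simp, subst mult_four_block_mat) auto
  moreover have "diag_mat (0\<^sub>m r r :: real mat) = replicate r 0"
    by (auto simp: diag_mat_def intro: nth_equalityI)
  then have "char_poly (0\<^sub>m r r :: real mat) = [:0, 1:] ^ r"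
    by (subst char_poly_upper_triangular[of _ r]) auto
  \<comment> \<open>The roots of a product are the sum of the root multisets only for nonzero
    factors.\<close>
  moreover have "char_poly (transpose_mat R * R) \<noteq> 0"
    using degree_monic_char_poly[of "transpose_mat R * R" "p - r"] R by auto
  ultimately have "proots (char_poly (transpose_mat ?M * ?M)) =
      repeat_mset r {#0#} + proots (char_poly (transpose_mat R * R))"
    using R by (simp add: char_poly_block_diag[of _ r _ "p - r"] proots_mult proots_power)
  moreover have "repeat_mset r {#0 :: real#} = replicate_mset r 0"
    by (simp add: multiset_eq_iff)
  ultimately show ?thesis
    by (simp add: singular_values_def)
qed

text \<open>This gives the block \<open>R\<close> a typed counterpart on which \<open>onorm\<close>
  makes sense. Padding adds zeros to the singular values, and zeros do not change the maximum of a
  nonempty set of nonnegative numbers.\<close>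

lemma op_norm_eq_onorm:
  fixes R :: "real mat"
  assumes R: "R \<in> carrier_mat (CARD('n) - r) (CARD('p) - r)"
    and rp: "r \<le> CARD('p)" and pn: "CARD('p) \<le> CARD('n)"
  shows "op_norm R = onorm ((*v) (of_mat (four_block_mat (0\<^sub>m r r) (0\<^sub>m r (CARD('p) - r)) (0\<^sub>m (CARD('n) - r) r) R)
     :: real^('p::{finite,linorder})^('n::{finite,linorder})))"
proof -
  let ?M = "four_block_mat (0\<^sub>m r r) (0\<^sub>m r (CARD('p) - r)) (0\<^sub>m (CARD('n) - r) r) R"
  let ?Z = "of_mat ?M :: real^('p::{finite,linorder})^('n::{finite,linorder})"
  have rn: "r \<le> CARD('n)" using rp pn by simp
  show ?thesis
  proof (cases "r = CARD('p)")
    \<comment> \<open>Here \<open>R\<close> has no columns: its norm is \<open>0\<close> by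
      convention, and the padded matrix is zero.\<close>
    case True
    have "?M $$ (index_pos i, index_pos j) = 0" for i :: 'n and j :: 'p
      using True index_pos_less[of i] index_pos_less[of j] rn R by (auto simp: carrier_matD[OF R])
    then have "?Z = 0"
      by (simp add: of_mat_def vec_eq_iff)
    moreover have "op_norm R = 0" using R True by (auto simp: op_norm_def)
    ultimately show ?thesis by (simp add: onorm_zero_matrix)
  next
    \<comment> \<open>Now \<open>R\<close> has a column, and by \<open>pn\<close> also a row, so
      \<open>op_norm R\<close> is a genuine maximum.\<close>
    case False
    have "?M \<in> carrier_mat CARD('n) CARD('p)" using R rp rn by auto
    then have Z: "to_mat ?Z = ?M" by (rule to_mat_of_mat)
    have ms: "mset (singular_values (to_mat ?Z)) = replicate_mset r 0 + mset (singular_values R)"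
      unfolding Z by (rule mset_singular_values_corner[OF R rp rn])
    have "length (singular_values R) = CARD('p) - r"
      using arg_cong[OF ms, of size] by (simp add: length_singular_values)
    then have ne: "set (singular_values R) \<noteq> {}" using False rp by auto
    have un: "set (singular_values (to_mat ?Z)) = (if r = 0 then {} else {0}) \<union> set (singular_values R)"
      using arg_cong[OF ms, of set_mset] by auto
    then have "0 \<le> s" if "s \<in> set (singular_values R)" for s
      using singular_values_nonneg that by blast
    then have "0 \<le> Max (set (singular_values R))"
      using ne by (simp add: Max_ge_iff ex_in_conv)
    then have "Max (set (singular_values (to_mat ?Z))) = Max (set (singular_values R))"
      using ne by (simp add: un)
    then show ?thesis
      using R False rp pn by (auto simp: op_norm_def onorm_eq_Max_singular_values)
  qed
qed

section \<open>The subdifferential\<close>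

lemma inner_gen_diag:
  fixes B :: "real^'p^'n"
  shows "inner B (gen_diag e t) = (\<Sum>j\<in>UNIV. t j * B $ e j $ j)"
proof -
  have "inner (column j B) (column j (gen_diag e t)) = t j * B $ e j $ j" for j
    by (simp add: inner_vec_def column_def gen_diag_def if_distrib[where f = "\<lambda>x. _ * x"] cong: if_cong)
  then show ?thesis by (simp add: inner_matrix_columns)
qed

lemma inner_orthogonal_sandwich:
  fixes U :: "real^'n^'n" and V :: "real^'p^'p" and A B :: "real^'p^'n"
  assumes "orthogonal_matrix U" "orthogonal_matrix V"
  shows "inner (U ** A ** transp V) (U ** B ** transp V) = inner A B"
  using assms by (simp add: inner_orthogonal_left inner_orthogonal_right)

lemma sandwich_cancel:
  fixes U :: "real^'n^'n" and V :: "real^'p^'p" and A :: "real^'p^'n"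
  assumes "orthogonal_matrix U" "orthogonal_matrix V"
  shows "U ** (transp U ** A ** V) ** transp V = A" "transp U ** (U ** A ** transp V) ** V = A"
proof -
  have "U ** (transp U ** A ** V) ** transp V = (U ** transp U) ** A ** (V ** transp V)"
    "transp U ** (U ** A ** transp V) ** V = (transp U ** U) ** A ** (transp V ** V)"
    by (simp_all add: matrix_mul_assoc)
  then show "U ** (transp U ** A ** V) ** transp V = A" "transp U ** (U ** A ** transp V) ** V = A"
    using assms by (simp_all add: orthogonal_matrix_def)
qed

lemma contraction_sandwich:
  fixes U :: "real^'n^'n" and V :: "real^'p^'p" and A :: "real^'p^'n"
  assumes "orthogonal_matrix U" "orthogonal_matrix V" and A: "\<And>x. norm (A *v x) \<le> norm x"
  shows "norm ((U ** A ** V) *v x) \<le> norm x"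
proof -
  have "norm ((U ** A ** V) *v x) = norm (A *v (V *v x))"
    by (simp add: matrix_vector_mul_assoc[symmetric] norm_orthogonal_mult assms(1))
  also have "\<dots> \<le> norm x" using A[of "V *v x"] assms(2) by (simp add: norm_orthogonal_mult)
  finally show ?thesis .
qed

section \<open>Contractions with diagonal entries equal to 1\<close>

lemma eq_axis_if_norm_le_1:
  fixes x :: "real^'n"
  assumes "norm x \<le> 1" "x $ i = 1"
  shows "x = axis i 1"
proof -
  \<comment> \<open>Expanding the square gives the cross term \<open>- 2 * x $ i\<close>, which is
    \<open>-2\<close>.\<close>
  have "inner (x - axis i 1) (x - axis i 1) = (norm x)\<^sup>2 - 1"
    using assms(2) unfolding power2_norm_eq_inner
    by (simp add: inner_diff_left inner_diff_right inner_axis inner_axis' del: dot_square_norm)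
  also have "\<dots> \<le> 0" using assms(1) by (simp add: power_le_one)
  finally have "\<not> 0 < inner (x - axis i 1) (x - axis i 1)" by linarith
  then show ?thesis unfolding inner_gt_zero_iff by simp
qed

lemma column_contraction:
  fixes B :: "real^'p^'n"
  assumes B: "\<And>x. norm (B *v x) \<le> norm x" and "B $ i $ j = 1"
  shows "column j B = axis i 1"
proof (rule eq_axis_if_norm_le_1)
  show "norm (column j B) \<le> 1" using B[of "axis j 1"] by (simp add: matrix_vector_mult_basis)
qed (simp add: column_def assms(2))

lemma row_contraction:
  fixes B :: "real^'p^'n"
  assumes B: "\<And>x. norm (B *v x) \<le> norm x" and "B $ i $ j = 1"
  shows "B $ i = axis j 1"
proof (rule eq_axis_if_norm_le_1)
  \<comment> \<open>Applying \<open>B\<close> to its own row \<open>i\<close> produces the squared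
    norm of the row as a component, so this square is at most the norm itself.\<close>
  have "norm (B $ i) * norm (B $ i) = (B *v (B $ i)) $ i"
    by (simp add: matrix_vector_mul_component dot_square_norm power2_eq_square)
  also have "\<dots> \<le> norm (B *v (B $ i))"
    by (metis abs_le_D1 component_le_norm_cart)
  also have "\<dots> \<le> 1 * norm (B $ i)" using B by simp
  finally show "norm (B $ i) \<le> 1"
    by (cases "B $ i = 0") (simp_all add: mult_le_cancel_right)
qed fact

text \<open>With \<open>e = embed_index\<close> and \<open>J\<close> the columns at positions below
  \<open>r\<close>, this is the part of the block matrices that holds the identity of size
  \<open>r\<close>.\<close>

definition unit_diag :: "('p::finite \<Rightarrow> 'n::finite) \<Rightarrow> 'p set \<Rightarrow> real^'p^'n" where
  "unit_diag e J = gen_diag e (\<lambda>j. if j \<in> J then 1 else 0)"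

text \<open>The matrices with a single free block, described by their zero rows and columns, so that
  no block size enters a type.\<close>

definition corner :: "'n set \<Rightarrow> 'p set \<Rightarrow> (real^'p^'n) set" where
  "corner I J = {K. \<forall>i j. i \<in> I \<or> j \<in> J \<longrightarrow> K $ i $ j = 0}"

text \<open>The orthogonal projection onto the coordinates outside \<open>J\<close>.\<close>

definition vanish_on :: "'p set \<Rightarrow> real^'p \<Rightarrow> real^'p" where
  "vanish_on J x = (\<chi> j. if j \<in> J then 0 else x $ j)"

lemma norm_vanish_on: "(norm x)\<^sup>2 = (norm (vanish_on J x))\<^sup>2 + (\<Sum>j\<in>J. (x $ j)\<^sup>2)"
proof -
  have "(norm x)\<^sup>2 = (\<Sum>j\<in>UNIV. (if j \<in> J then 0 else (x $ j)\<^sup>2) + (if j \<in> J then (x $ j)\<^sup>2 else 0))"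
    unfolding power2_norm_eq_inner inner_vec_def by (intro sum.cong) (auto simp: power2_eq_square)
  also have "\<dots> = (\<Sum>j\<in>UNIV. if j \<in> J then 0 else (x $ j)\<^sup>2) + (\<Sum>j\<in>J. (x $ j)\<^sup>2)"
    by (simp add: sum.distrib sum.If_cases)
  also have "(\<Sum>j\<in>UNIV. if j \<in> J then 0 else (x $ j)\<^sup>2) = (norm (vanish_on J x))\<^sup>2"
    unfolding power2_norm_eq_inner inner_vec_def
    by (intro sum.cong) (auto simp: vanish_on_def power2_eq_square)
  finally show ?thesis .
qed

lemma norm_vanish_on_le: "norm (vanish_on J x) \<le> norm x"
proof (rule power2_le_imp_le)
  have "0 \<le> (\<Sum>j\<in>J. (x $ j)\<^sup>2)" by (simp add: sum_nonneg)
  then show "(norm (vanish_on J x))\<^sup>2 \<le> (norm x)\<^sup>2"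
    using norm_vanish_on[of x J] by linarith
qed simp

lemma corner_mult_vanish_on:
  assumes "K \<in> corner I J"
  shows "K *v vanish_on J x = K *v x"
  using assms by (auto simp: vec_eq_iff matrix_vector_mult_def vanish_on_def corner_def intro!: sum.cong)

lemma unit_diag_mult_component:
  assumes e: "inj e"
  shows "(unit_diag e J *v x) $ e j = (if j \<in> J then x $ j else 0)"
  using e by (simp add: unit_diag_def gen_diag_def matrix_vector_mult_def inj_eq
      if_distrib[where f = "\<lambda>x. x * _"] cong: if_cong)

lemma unit_diag_mult_zero:
  assumes "i \<notin> e ` J"
  shows "(unit_diag e J *v x) $ i = 0"
  using assms by (auto simp: unit_diag_def gen_diag_def matrix_vector_mult_def intro!: sum.neutral)

text \<open>Pythagoras on both sides: the two summands have images supported on complementary sets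
  of rows, and they depend on complementary sets of coordinates of \<open>x\<close>.\<close>

lemma contraction_unit_diag_plus_corner:
  fixes K :: "real^'p^'n"
  assumes e: "inj e" and K: "K \<in> corner (e ` J) J" and c: "\<And>x. norm (K *v x) \<le> norm x"
  shows "norm ((unit_diag e J + K) *v x) \<le> norm x"
proof -
  let ?a = "unit_diag e J *v x" and ?b = "K *v x"
  have "(K *v x) $ i = 0" if "i \<in> e ` J" for i
    using K that by (auto simp: corner_def matrix_vector_mult_def intro!: sum.neutral)
  then have "?a $ i * ?b $ i = 0" for i
    by (cases "i \<in> e ` J") (simp_all add: unit_diag_mult_zero)
  then have "inner ?a ?b = 0"
    unfolding inner_vec_def by (intro sum.neutral) auto
  then have "(norm ((unit_diag e J + K) *v x))\<^sup>2 = (norm ?a)\<^sup>2 + (norm ?b)\<^sup>2"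
    unfolding matrix_vector_mult_add_rdistrib power2_norm_eq_inner
    by (simp add: inner_add_left inner_add_right inner_commute del: dot_square_norm)
  also have "(norm ?a)\<^sup>2 = (\<Sum>i\<in>e ` J. (?a $ i)\<^sup>2)"
    unfolding power2_norm_eq_inner inner_vec_def
    by (rule sum.mono_neutral_cong_right) (auto simp: unit_diag_mult_zero power2_eq_square)
  also have "\<dots> = (\<Sum>j\<in>J. (x $ j)\<^sup>2)"
    by (subst sum.reindex[OF inj_on_subset[OF e subset_UNIV]]) (simp add: unit_diag_mult_component[OF e])
  also have "(\<Sum>j\<in>J. (x $ j)\<^sup>2) + (norm ?b)\<^sup>2 \<le> (\<Sum>j\<in>J. (x $ j)\<^sup>2) + (norm (vanish_on J x))\<^sup>2"
    using c[of "vanish_on J x"] by (simp add: corner_mult_vanish_on[OF K] power_mono)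
  finally have "(norm ((unit_diag e J + K) *v x))\<^sup>2 \<le> (norm x)\<^sup>2"
    using norm_vanish_on[of x J] by linarith
  then show ?thesis by (rule power2_le_imp_le) simp
qed

lemma contraction_decompose:
  fixes B :: "real^'p^'n"
  assumes e: "inj e" and c: "\<And>x. norm (B *v x) \<le> norm x" and d: "\<And>j. j \<in> J \<Longrightarrow> B $ e j $ j = 1"
  shows "B - unit_diag e J \<in> corner (e ` J) J"
    and "norm ((B - unit_diag e J) *v x) \<le> norm x"
proof -
  have col: "B $ i $ j = (if i = e j then 1 else 0)" if "j \<in> J" for i j
    using arg_cong[OF column_contraction[OF c d[OF that]], of "\<lambda>v. v $ i"]
    by (auto simp: column_def axis_def)
  have row: "B $ e k $ j = (if j = k then 1 else 0)" if "k \<in> J" for k j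
    using row_contraction[OF c d[OF that]] by (auto simp: axis_def)
  show K: "B - unit_diag e J \<in> corner (e ` J) J"
    using e by (auto simp: corner_def unit_diag_def gen_diag_def col row inj_eq)
  have "unit_diag e J *v vanish_on J x = 0"
    by (auto simp: unit_diag_def gen_diag_def vanish_on_def matrix_vector_mult_def vec_eq_iff
        intro!: sum.neutral)
  \<comment> \<open>The remainder is \<open>B\<close> preceded by a projection, hence again a
    contraction.\<close>
  then have "(B - unit_diag e J) *v x = B *v vanish_on J x"
    using corner_mult_vanish_on[OF K, of x] by (simp add: matrix_vector_mult_diff_rdistrib)
  then show "norm ((B - unit_diag e J) *v x) \<le> norm x"
    using c[of "vanish_on J x"] norm_vanish_on_le[of J x] by simp
qed

text \<open>The test matrix is the rank-one matrix built from the unit vectors in the directions of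
  \<open>Y *v x\<close> and \<open>x\<close>. Its nuclear norm is 1, and its inner product with
  \<open>Y\<close> is \<open>norm (Y *v x) / norm x\<close>.\<close>

lemma contraction_if_inner_le_nuclear_norm:
  fixes Y :: "real^('p::{finite,linorder})^('n::{finite,linorder})" and e :: "'p \<Rightarrow> 'n"
  assumes e: "inj e" and Y: "\<And>Z. inner Y Z \<le> nuclear_norm Z"
  shows "norm (Y *v x) \<le> norm x"
proof (cases "Y *v x = 0")
  case False
  then have x: "x \<noteq> 0" by auto
  \<comment> \<open>An arbitrary column index: \<open>k\<close> and \<open>e k\<close> mark the
    columns of \<open>V\<close> and \<open>U\<close> that carry the two unit vectors.\<close>
  obtain k :: 'p where True by simp
  obtain V :: "real^('p::{finite,linorder})^('p::{finite,linorder})" where V: "orthogonal_matrix V" "V *v axis k 1 = (1 / norm x) *\<^sub>R x"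
    using orthogonal_matrix_exists_basis[of "(1 / norm x) *\<^sub>R x" k] x by auto
  let ?y = "(1 / norm (Y *v x)) *\<^sub>R (Y *v x)"
  obtain U :: "real^('n::{finite,linorder})^('n::{finite,linorder})" where U: "orthogonal_matrix U" "U *v axis (e k) 1 = ?y"
    using orthogonal_matrix_exists_basis[of ?y "e k"] False by auto
  let ?D = "gen_diag e (\<lambda>j. if j = k then 1 else 0) :: real^('p::{finite,linorder})^('n::{finite,linorder})"
  have "inner Y (U ** ?D ** transp V) = inner (U ** (transp U ** Y ** V) ** transp V) (U ** ?D ** transp V)"
    by (simp add: sandwich_cancel U V)
  also have "\<dots> = inner (transp U ** Y ** V) ?D"
    by (simp add: inner_orthogonal_sandwich U V)
  also have "\<dots> = (transp U ** (Y ** V)) $ e k $ k"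
    unfolding matrix_mul_assoc by (simp add: inner_gen_diag if_distrib[where f = "\<lambda>x. x * _"] cong: if_cong)
  also have "\<dots> = inner ?y (Y *v ((1 / norm x) *\<^sub>R x))"
    unfolding transpose_mult_component column_mult U(2)[symmetric] V(2)[symmetric]
    by (simp add: matrix_vector_mult_basis)
  also have "\<dots> = norm (Y *v x) / norm x"
    using False by (simp add: matrix_vector_mult_scaleR dot_square_norm power2_eq_square)
  finally have "norm (Y *v x) / norm x \<le> nuclear_norm (U ** ?D ** transp V)"
    using Y by metis
  also have "\<dots> = 1"
    by (subst nuclear_norm_gen_diag[OF U(1) V(1) e]) auto
  finally show ?thesis using x by (simp add: divide_simps split: if_splits)
qed simp

text \<open>Part (a) in a form without order or rank: the support \<open>J\<close> of the diagonal
  replaces the first \<open>r\<close> positions.\<close>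

lemma subdifferential_nuclear_norm:
  fixes U :: "real^('n::{finite,linorder})^('n::{finite,linorder})"
    and V :: "real^('p::{finite,linorder})^('p::{finite,linorder})" and e :: "'p \<Rightarrow> 'n"
  assumes U: "orthogonal_matrix U" and V: "orthogonal_matrix V" and e: "inj e"
    and t: "\<And>j. 0 \<le> t j" and J: "J = {j. t j \<noteq> 0}"
  shows "subdifferential nuclear_norm (U ** gen_diag e t ** transp V) =
    sandwich U ((+) (unit_diag e J) ` {K \<in> corner (e ` J) J. onorm ((*v) K) \<le> 1}) V"
proof (intro equalityI subsetI)
  let ?X = "U ** gen_diag e t ** transp V"
  have contr: "onorm ((*v) K) \<le> 1 \<longleftrightarrow> (\<forall>x. norm (K *v x) \<le> norm x)" for K :: "real^('p::{finite,linorder})^('n::{finite,linorder})"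
    using onorm_matrix_le_iff[of 1 K] by simp
  have tsum: "(\<Sum>j\<in>UNIV. t j * B $ e j $ j) = (\<Sum>j\<in>UNIV. t j)"
    if "\<And>j. j \<in> J \<Longrightarrow> B $ e j $ j = 1" for B :: "real^('p::{finite,linorder})^('n::{finite,linorder})"
    using that by (intro sum.cong) (auto simp: J)
  {
    fix Y assume "Y \<in> sandwich U ((+) (unit_diag e J) ` {K \<in> corner (e ` J) J. onorm ((*v) K) \<le> 1}) V"
    then obtain K where K: "K \<in> corner (e ` J) J" "\<And>x. norm (K *v x) \<le> norm x"
      and Y: "Y = U ** (unit_diag e J + K) ** transp V"
      by (auto simp: sandwich_def contr)
    have "norm (Y *v x) \<le> norm x" for x
      unfolding Y using U V by (intro contraction_sandwich contraction_unit_diag_plus_corner[OF e K]) simp_all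
    then have le: "inner Y Z \<le> nuclear_norm Z" for Z by (rule inner_le_nuclear_norm)
    have "(unit_diag e J + K) $ e j $ j = 1" if "j \<in> J" for j
      using K(1) that by (auto simp: corner_def unit_diag_def gen_diag_def)
    then have "inner Y ?X = nuclear_norm ?X"
      by (simp add: Y inner_orthogonal_sandwich[OF U V] inner_gen_diag tsum nuclear_norm_gen_diag[OF U V e t]
          del: vector_add_component)
    then show "Y \<in> subdifferential nuclear_norm ?X"
      using le by (simp add: subdifferential_def inner_diff_right)
  next
    fix Y assume Y: "Y \<in> subdifferential nuclear_norm ?X"
    define B where "B = transp U ** Y ** V"
    have YB: "Y = U ** B ** transp V" by (simp add: B_def sandwich_cancel U V)
    \<comment> \<open>On matrices with the same \<open>U\<close> and \<open>V\<close> and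
      nonnegative diagonal, the nuclear norm is linear in the diagonal, so the subgradient
      inequality becomes a linear condition on the diagonal of \<open>B\<close>.\<close>
    have test: "(\<Sum>j\<in>UNIV. (s j - t j) * (B $ e j $ j - 1)) \<le> 0" if s: "\<And>j. 0 \<le> s j" for s
    proof -
      have "nuclear_norm ?X + inner Y (U ** gen_diag e s ** transp V - ?X)
          \<le> nuclear_norm (U ** gen_diag e s ** transp V)"
        using Y by (simp add: subdifferential_def)
      then have "(\<Sum>j\<in>UNIV. t j) + ((\<Sum>j\<in>UNIV. s j * B $ e j $ j) - (\<Sum>j\<in>UNIV. t j * B $ e j $ j)) \<le> (\<Sum>j\<in>UNIV. s j)"
        by (simp add: YB inner_diff_right inner_orthogonal_sandwich[OF U V] inner_gen_diag
            nuclear_norm_gen_diag[OF U V e t] nuclear_norm_gen_diag[OF U V e s])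
      then show ?thesis by (simp add: algebra_simps sum.distrib sum_subtractf)
    qed
    have BJ: "B $ e j $ j = 1" if "j \<in> J" for j
    proof -
      have tj: "t j > 0" using that t[of j] by (auto simp: J)
      have single: "(\<Sum>i\<in>UNIV. ((t(j := a)) i - t i) * (B $ e i $ i - 1)) = (a - t j) * (B $ e j $ j - 1)" for a
      proof -
        have "(\<Sum>i\<in>UNIV. ((t(j := a)) i - t i) * (B $ e i $ i - 1)) =
            (\<Sum>i\<in>UNIV. if i = j then (a - t j) * (B $ e j $ j - 1) else 0)"
          by (intro sum.cong) auto
        then show ?thesis by simp
      qed
      \<comment> \<open>Raising the entry \<open>t j\<close> bounds the diagonal entry of
        \<open>B\<close> by 1 from above; lowering it to \<open>0\<close>, a real decrease as
        \<open>t j > 0\<close>, bounds it from below.\<close>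
      have "(t j + 1 - t j) * (B $ e j $ j - 1) \<le> 0"
        using test[of "t(j := t j + 1)"] t tj unfolding single by (auto intro: add_nonneg_nonneg)
      moreover have "(0 - t j) * (B $ e j $ j - 1) \<le> 0"
        using test[of "t(j := 0)"] t unfolding single by auto
      ultimately show ?thesis using tj zero_le_mult_iff[of "t j" "B $ e j $ j - 1"] by auto
    qed
    \<comment> \<open>With this equality the terms at \<open>?X\<close> cancel from the subgradient
      inequality.\<close>
    have "inner Y ?X = nuclear_norm ?X"
      by (simp add: YB inner_orthogonal_sandwich[OF U V] inner_gen_diag tsum BJ nuclear_norm_gen_diag[OF U V e t])
    then have "inner Y Z \<le> nuclear_norm Z" for Z
      using Y by (simp add: subdifferential_def inner_diff_right)
    then have "norm (Y *v x) \<le> norm x" for x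
      by (rule contraction_if_inner_le_nuclear_norm[OF e])
    then have "norm (B *v x) \<le> norm x" for x
      unfolding B_def using U V by (intro contraction_sandwich) simp_all
    from contraction_decompose[OF e this BJ]
    have "B - unit_diag e J \<in> {K \<in> corner (e ` J) J. onorm ((*v) K) \<le> 1}"
      by (simp add: contr)
    then have "B \<in> (+) (unit_diag e J) ` {K \<in> corner (e ` J) J. onorm ((*v) K) \<le> 1}"
      by (intro image_eqI[of _ _ "B - unit_diag e J"]) auto
    then show "Y \<in> sandwich U ((+) (unit_diag e J) ` {K \<in> corner (e ` J) J. onorm ((*v) K) \<le> 1}) V"
      using YB by (auto simp: sandwich_def)
  }
qed

section \<open>Rank, relative interior and affine hull\<close>

lemma range_gen_diag:
  fixes e :: "'p::finite \<Rightarrow> 'n::finite"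
  assumes e: "inj e"
  shows "range ((*v) (gen_diag e t)) = {x :: real^'n. \<forall>i. i \<notin> e ` {j. t j \<noteq> 0} \<longrightarrow> x $ i = 0}"
proof -
  have comp: "(gen_diag e t *v x) $ e j = t j * x $ j" for x j
    using e by (simp add: gen_diag_def matrix_vector_mult_def inj_eq
        if_distrib[where f = "\<lambda>x. x * _"] cong: if_cong)
  have zero: "(gen_diag e t *v x) $ i = 0" if "i \<notin> e ` {j. t j \<noteq> 0}" for x i
    using that by (auto simp: gen_diag_def matrix_vector_mult_def intro!: sum.neutral)
  show ?thesis
  proof (intro Set.set_eqI iffI)
    fix y assume y: "y \<in> {x :: real^'n. \<forall>i. i \<notin> e ` {j. t j \<noteq> 0} \<longrightarrow> x $ i = 0}"
    \<comment> \<open>Where \<open>t j = 0\<close> the quotient is \<open>0\<close> by convention;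
      \<open>gen_diag e t\<close> annihilates these coordinates anyway.\<close>
    have "gen_diag e t *v (\<chi> j. y $ e j / t j) = y"
      unfolding vec_eq_iff
    proof
      fix i
      show "(gen_diag e t *v (\<chi> j. y $ e j / t j)) $ i = y $ i"
        using y by (cases "i \<in> e ` {j. t j \<noteq> 0}") (auto simp: comp zero)
    qed
    then show "y \<in> range ((*v) (gen_diag e t))" by (metis rangeI)
  qed (auto intro: zero)
qed

lemma rank_gen_diag:
  fixes e :: "'p::finite \<Rightarrow> 'n::finite"
  assumes e: "inj e"
  shows "rank (gen_diag e t) = card {j. t j \<noteq> 0}"
  using dim_substandard_cart[of "e ` {j. t j \<noteq> 0}", where ?'a = real]
  by (simp add: rank_dim_range range_gen_diag[OF e] dim_vec_eq card_image inj_on_subset[OF e])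

lemma rank_orthogonal_mult:
  fixes U :: "real^'n^'n" and D :: "real^'p^'n" and V :: "real^'p^'p"
  assumes U: "orthogonal_matrix U" and V: "orthogonal_matrix V"
  shows "rank (U ** D ** transp V) = rank D"
proof (rule antisym)
  show "rank (U ** D ** transp V) \<le> rank D"
    using rank_mul_le_left rank_mul_le_right order_trans by blast
  have "transp U ** (U ** D ** transp V) ** V = (transp U ** U) ** D ** (transp V ** V)"
    by (simp add: matrix_mul_assoc)
  also have "\<dots> = D" using U V by (simp add: orthogonal_matrix_def)
  finally show "rank D \<le> rank (U ** D ** transp V)"
    by (metis rank_mul_le_left rank_mul_le_right order_trans)
qed

text \<open>Besides convexity of the unit ball this yields continuity of the operator norm, as a
  convex function on a finite-dimensional space is continuous; hence the strict sublevel set is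
  open.\<close>

lemma convex_onorm: "convex_on UNIV (\<lambda>A :: real^'p^'n. onorm ((*v) A))"
proof (rule convex_onI)
  fix t :: real and A B :: "real^'p^'n"
  assume t: "0 < t" "t < 1"
  have "(*v) ((1 - t) *\<^sub>R A + t *\<^sub>R B) = (\<lambda>x. (1 - t) *\<^sub>R (A *v x) + t *\<^sub>R (B *v x))"
    by (rule ext) (simp add: matrix_vector_mult_add_rdistrib scaleR_matrix_vector_assoc)
  then have "onorm ((*v) ((1 - t) *\<^sub>R A + t *\<^sub>R B)) = onorm (\<lambda>x. (1 - t) *\<^sub>R (A *v x) + t *\<^sub>R (B *v x))"
    by simp
  also have "\<dots> \<le> onorm (\<lambda>x. (1 - t) *\<^sub>R (A *v x)) + onorm (\<lambda>x. t *\<^sub>R (B *v x))"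
    by (intro onorm_triangle bounded_linear_scaleR_right[THEN bounded_linear_compose]
        matrix_vector_mul_bounded_linear)
  also have "\<dots> = (1 - t) * onorm ((*v) A) + t * onorm ((*v) B)"
    using t by (simp add: onorm_scaleR matrix_vector_mul_bounded_linear)
  finally show "onorm ((*v) ((1 - t) *\<^sub>R A + t *\<^sub>R B)) \<le> (1 - t) * onorm ((*v) A) + t * onorm ((*v) B)" .
qed auto

lemma onorm_ball:
  fixes c :: real
  defines "S \<equiv> {A :: real^'p^'n. onorm ((*v) A) \<le> 1}"
  shows "convex S" "interior S = {A. onorm ((*v) A) < 1}"
proof -
  show "convex S"
    unfolding convex_def
  proof (clarsimp simp: S_def)
    fix A B :: "real^'p^'n" and u v :: real
    assume le: "onorm ((*v) A) \<le> 1" "onorm ((*v) B) \<le> 1" and uv: "0 \<le> u" "0 \<le> v" "u + v = 1"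
    have "onorm ((*v) (u *\<^sub>R A + v *\<^sub>R B)) \<le> u * onorm ((*v) A) + v * onorm ((*v) B)"
      using convex_onorm uv by (auto simp: convex_on_def)
    also have "\<dots> \<le> 1" using le uv by (rule convex_bound_le)
    finally show "onorm ((*v) (u *\<^sub>R A + v *\<^sub>R B)) \<le> 1" .
  qed
  show "interior S = {A. onorm ((*v) A) < 1}"
  proof (intro equalityI subsetI)
    fix A assume "A \<in> interior S"
    then obtain \<epsilon> where \<epsilon>: "\<epsilon> > 0" "ball A \<epsilon> \<subseteq> S" by (meson mem_interior)
    \<comment> \<open>An interior point may be stretched by the factor \<open>1 + \<delta>\<close>
      without leaving the ball, so its norm is strictly below 1. The summand 1 in the denominator
      covers \<open>A = 0\<close>.\<close>
    define \<delta> where "\<delta> = \<epsilon> / (2 * (norm A + 1))"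
    have \<delta>: "\<delta> > 0" using \<epsilon>(1) by (auto simp: \<delta>_def intro!: divide_pos_pos add_nonneg_pos)
    have "\<delta> * norm A < \<epsilon>"
      using \<epsilon>(1) unfolding \<delta>_def by (simp add: divide_simps add_nonneg_pos)
    then have "(1 + \<delta>) *\<^sub>R A \<in> ball A \<epsilon>" using \<delta> by (simp add: dist_norm scaleR_add_left)
    then have "onorm ((*v) ((1 + \<delta>) *\<^sub>R A)) \<le> 1" using \<epsilon>(2) by (auto simp: S_def)
    then have "(1 + \<delta>) * onorm ((*v) A) \<le> 1"
      using onorm_scaleR[OF matrix_vector_mul_bounded_linear, of "1 + \<delta>" A] \<delta>
      by (simp add: scaleR_matrix_vector_assoc)
    moreover have "onorm ((*v) A) = 0 \<or> onorm ((*v) A) < (1 + \<delta>) * onorm ((*v) A)"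
      using \<delta> onorm_pos_le[OF matrix_vector_mul_bounded_linear, of A]
      by (auto simp: distrib_right zero_less_mult_iff)
    ultimately show "A \<in> {A. onorm ((*v) A) < 1}" by auto
  next
    fix A :: "real^'p^'n"
    assume A: "A \<in> {A. onorm ((*v) A) < 1}"
    have "open {A :: real^'p^'n. onorm ((*v) A) < 1}"
      using convex_on_continuous[OF open_UNIV convex_onorm]
      by (intro open_Collect_less continuous_on_const) auto
    then show "A \<in> interior S"
      using A by (rule_tac interiorI) (auto simp: S_def)
  qed
qed

lemma subspace_corner: "subspace (corner I J)"
  by (auto simp: corner_def subspace_def)

text \<open>The set is the intersection of a subspace with a convex set whose interior meets that
  subspace, namely at \<open>0\<close>. Then the relative interior is the trace of the interior, and
  the affine hull is the whole subspace.\<close>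

lemma corner_ball:
  shows rel_interior_corner_ball:
    "rel_interior {K \<in> corner I J. onorm ((*v) K) \<le> 1} = {K \<in> corner I J. onorm ((*v) K) < 1}"
  and affine_hull_corner_ball:
    "affine hull {K \<in> corner I J. onorm ((*v) K) \<le> 1} = corner I J"
proof -
  let ?S = "{A :: real^'a^'b. onorm ((*v) A) \<le> 1}"
  have eq: "{K \<in> corner I J. onorm ((*v) K) \<le> 1} = corner I J \<inter> ?S" by auto
  have "0 \<in> corner I J \<inter> interior ?S"
    using subspace_0[OF subspace_corner] by (simp add: onorm_ball(2))
  then have ne: "corner I J \<inter> interior ?S \<noteq> {}" by blast
  have aff: "affine (corner I J)" by (rule subspace_imp_affine[OF subspace_corner])
  show "rel_interior {K \<in> corner I J. onorm ((*v) K) \<le> 1} = {K \<in> corner I J. onorm ((*v) K) < 1}"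
    using rel_interior_convex_Int_affine[OF onorm_ball(1) aff] ne
    by (auto simp: eq onorm_ball(2) Int_commute)
  show "affine hull {K \<in> corner I J. onorm ((*v) K) \<le> 1} = corner I J"
    unfolding eq using affine_hull_affine_Int_nonempty_interior[OF aff ne] aff
    by (simp add: affine_hull_eq)
qed

lemma down_closed_eq_lessThan_card:
  fixes A :: "nat set"
  assumes "finite A" and down: "\<And>k l. l \<in> A \<Longrightarrow> k \<le> l \<Longrightarrow> k \<in> A"
  shows "A = {..<card A}"
proof (rule card_subset_eq)
  show "A \<subseteq> {..<card A}"
  proof
    fix k assume "k \<in> A"
    then have "{..k} \<subseteq> A" using down by auto
    then have "card {..k} \<le> card A" using assms(1) by (rule card_mono[rotated])
    then show "k \<in> {..<card A}" by simp
  qed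
qed auto

text \<open>In a nonincreasing list of nonnegative numbers the nonzero entries occupy an initial
  segment, whose length is their number. This identifies the support of the diagonal with the first
  \<open>r\<close> positions.\<close>

lemma singular_value_nonzero_iff:
  fixes X :: "real^('p::{finite,linorder})^('n::{finite,linorder})"
  defines "s \<equiv> singular_values (to_mat X)"
  shows "s ! index_pos (j :: 'p) \<noteq> 0 \<longleftrightarrow> index_pos j < card {j :: 'p. s ! index_pos j \<noteq> 0}"
proof -
  let ?J = "{j :: 'p. s ! index_pos j \<noteq> 0}"
  have len: "length s = CARD('p)" by (simp add: s_def length_singular_values)
  have srt: "sorted (rev s)" by (simp add: s_def singular_values_def)
  have nonneg: "0 \<le> s ! k" if "k < CARD('p)" for k
    using singular_values_nonneg[of "s ! k" X] nth_mem[of k s] that len by (simp add: s_def)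
  have "index_pos ` ?J = {..<card (index_pos ` ?J)}"
  proof (rule down_closed_eq_lessThan_card)
    fix k l assume "l \<in> index_pos ` ?J" "k \<le> l"
    then obtain i :: 'p where i: "s ! index_pos i \<noteq> 0" "k \<le> index_pos i" by auto
    then have k: "k < CARD('p)" using index_pos_less[of i] by simp
    have "s ! index_pos i \<le> s ! k"
      using sorted_rev_nth_mono[OF srt i(2)] index_pos_less[of i] len by simp
    then have "s ! k \<noteq> 0" using i(1) nonneg[OF index_pos_less[of i]] by linarith
    then show "k \<in> index_pos ` ?J"
      using k by (intro image_eqI[of _ _ "index_at k"]) (simp_all add: index_pos_at)
  qed simp
  also have "card (index_pos ` ?J) = card ?J"
    by (intro card_image) (simp add: inj_on_def)
  finally have eq: "index_pos ` ?J = {..<card ?J}" .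
  have "j \<in> ?J \<longleftrightarrow> index_pos j \<in> index_pos ` ?J" by auto
  then show ?thesis unfolding eq by simp
qed

lemma linear_sandwich: "linear (\<lambda>B :: real^'p^'n. U ** B ** W)"
  by (rule linearI)
     (simp_all add: vec_eq_iff matrix_matrix_mult_def sum_distrib_left sum_distrib_right
        sum.distrib algebra_simps)

lemma sandwich_eq_image: "sandwich U M V = (\<lambda>B. U ** B ** transp V) ` M"
  by (auto simp: sandwich_def)

lemma rel_interior_sandwich:
  assumes "orthogonal_matrix U" "orthogonal_matrix V"
  shows "rel_interior (sandwich U M V) = sandwich U (rel_interior M) V"
  unfolding sandwich_eq_image
  by (intro rel_interior_injective_linear_image)
     (auto simp: linear_conv_bounded_linear[symmetric] linear_sandwich
        intro!: inj_on_inverseI[of _ "\<lambda>A. transp U ** A ** V"] sandwich_cancel(2) assms)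

lemma affine_hull_sandwich: "affine hull (sandwich U M V) = sandwich U (affine hull M) V"
  unfolding sandwich_eq_image
  by (intro affine_hull_linear_image[symmetric]) (simp add: linear_conv_bounded_linear[symmetric] linear_sandwich)

section \<open>Block matrices\<close>

text \<open>Sends a column to the row at the same position, which exists when there are at least as
  many rows as columns; this marks the diagonal of a rectangular matrix.\<close>

definition embed_index :: "'p::{finite,linorder} \<Rightarrow> 'n::{finite,linorder}" where
  "embed_index j = index_at (index_pos j)"

context
  fixes r :: nat
  assumes le: "CARD('p::{finite,linorder}) \<le> CARD('n::{finite,linorder})"
begin

lemma index_pos_embed: "index_pos (embed_index (j :: 'p) :: 'n) = index_pos j"
  using index_pos_less[of j] le by (simp add: embed_index_def index_pos_at)

lemma inj_embed_index: "inj (embed_index :: 'p \<Rightarrow> 'n)"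
  by (metis index_pos_embed index_pos_eq_iff injI)

lemma eq_embed_index_iff: "i = (embed_index (j :: 'p) :: 'n) \<longleftrightarrow> index_pos i = index_pos j"
  by (metis index_pos_embed index_pos_eq_iff)

lemma embed_index_image:
  assumes "r \<le> CARD('p)"
  shows "embed_index ` {j :: 'p. index_pos j < r} = {i :: 'n. index_pos i < r}"
proof (intro Set.set_eqI iffI)
  fix i :: 'n assume i: "i \<in> {i. index_pos i < r}"
  then have "index_pos (index_at (index_pos i) :: 'p) = index_pos i"
    using assms by (simp add: index_pos_at)
  then show "i \<in> embed_index ` {j :: 'p. index_pos j < r}"
    using i by (intro image_eqI[of _ _ "index_at (index_pos i) :: 'p"]) (simp_all add: eq_embed_index_iff)
qed (auto simp: index_pos_embed)

lemma of_mat_rect_diag: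
  "(of_mat (rect_diag CARD('n) CARD('p) s) :: real^('p::{finite,linorder})^('n::{finite,linorder})) = gen_diag embed_index (\<lambda>j. s ! index_pos j)"
  by (auto simp: vec_eq_iff of_mat_def rect_diag_def gen_diag_def eq_embed_index_iff index_pos_less)

lemma of_mat_block_one:
  assumes r: "r \<le> CARD('p)" and R: "R \<in> carrier_mat (CARD('n) - r) (CARD('p) - r)"
  shows "(of_mat (four_block_mat (1\<^sub>m r) (0\<^sub>m r (CARD('p) - r)) (0\<^sub>m (CARD('n) - r) r) R) :: real^('p::{finite,linorder})^('n::{finite,linorder})) =
    unit_diag embed_index {j. index_pos j < r} +
    of_mat (four_block_mat (0\<^sub>m r r) (0\<^sub>m r (CARD('p) - r)) (0\<^sub>m (CARD('n) - r) r) R)"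
  unfolding vec_eq_iff
proof (intro allI)
  fix i :: 'n and j :: 'p
  have "index_pos i < r + (CARD('n) - r)" "index_pos j < r + (CARD('p) - r)"
    using index_pos_less[of i] index_pos_less[of j] r le by simp_all
  then show "(of_mat (four_block_mat (1\<^sub>m r) (0\<^sub>m r (CARD('p) - r)) (0\<^sub>m (CARD('n) - r) r) R) :: real^('p::{finite,linorder})^('n::{finite,linorder})) $ i $ j =
    (unit_diag embed_index {j. index_pos j < r} +
    of_mat (four_block_mat (0\<^sub>m r r) (0\<^sub>m r (CARD('p) - r)) (0\<^sub>m (CARD('n) - r) r) R)) $ i $ j"
    by (auto simp: of_mat_def unit_diag_def gen_diag_def eq_embed_index_iff carrier_matD[OF R])
qed

lemma corner_eq_of_mat_block:
  assumes r: "r \<le> CARD('p)"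
  shows "corner (embed_index ` {j :: 'p. index_pos j < r}) {j. index_pos j < r} =
    (\<lambda>R. of_mat (four_block_mat (0\<^sub>m r r) (0\<^sub>m r (CARD('p) - r)) (0\<^sub>m (CARD('n) - r) r) R) :: real^('p::{finite,linorder})^('n::{finite,linorder}))
      ` carrier_mat (CARD('n) - r) (CARD('p) - r)"
    (is "?C = ?b ` ?R")
proof (intro equalityI subsetI)
  \<comment> \<open>The bounds are put in the form in which \<open>four_block_mat\<close> states its
    dimensions.\<close>
  have less: "index_pos i < r + (CARD('n) - r)" "index_pos j < r + (CARD('p) - r)" for i :: 'n and j :: 'p
    using index_pos_less[of i] index_pos_less[of j] r le by simp_all
  {
    fix K assume K: "K \<in> ?C"
    \<comment> \<open>The lower right block of \<open>K\<close>, cut out by shifting both indices by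
      \<open>r\<close>.\<close>
    define R where "R = Matrix.mat (CARD('n) - r) (CARD('p) - r) (\<lambda>(i, j). to_mat K $$ (i + r, j + r))"
    have R: "R \<in> ?R" by (simp add: R_def)
    have "?b R $ i $ j = K $ i $ j" for i j
    proof (cases "index_pos i < r \<or> index_pos j < r")
      case True
      then show ?thesis
        using K less(1)[of i] less(2)[of j] by (auto simp: corner_def embed_index_image[OF r] of_mat_def carrier_matD[OF R])
    next
      case False
      then have "index_pos i - r < CARD('n) - r" "index_pos j - r < CARD('p) - r"
        using less(1)[of i] less(2)[of j] by linarith+
      then show ?thesis
        using False less(1)[of i] less(2)[of j] index_pos_less[of i] index_pos_less[of j]
        by (simp add: of_mat_def carrier_matD[OF R] R_def to_mat_def index_at_pos)
    qed
    then show "K \<in> ?b ` ?R" using R by (intro image_eqI[of _ _ R]) (simp_all add: vec_eq_iff)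
  next
    fix K assume "K \<in> ?b ` ?R"
    then obtain R where R: "R \<in> ?R" and K: "K = ?b R" by blast
    have "K $ i $ j = 0" if "index_pos i < r \<or> index_pos j < r" for i j
      using that less(1)[of i] less(2)[of j] index_pos_less[of i] index_pos_less[of j]
      by (auto simp: K of_mat_def carrier_matD[OF R])
    then show "K \<in> ?C" by (simp add: corner_def embed_index_image[OF r])
  }
qed

end

theorem proposition2p8:
  fixes X :: "real^('p::{finite,linorder})^('n::{finite,linorder})"
    and U :: "real^('n::{finite,linorder})^('n::{finite,linorder})"
    and V :: "real^('p::{finite,linorder})^('p::{finite,linorder})" and n p r :: nat
  assumes n: "n = CARD('n)" and p: "p = CARD('p)" and np: "p \<le> n"
    and r: "r = rank X"
    and U: "orthogonal_matrix U" and V: "orthogonal_matrix V"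
    and svd: "U ** of_mat (rect_diag n p (singular_values (to_mat X)))
                ** Finite_Cartesian_Product.transpose V = X"
  shows "subdifferential nuclear_norm X =
           sandwich U {of_mat (four_block_mat (1\<^sub>m r) (0\<^sub>m r (p - r)) (0\<^sub>m (n - r) r) R) | R.
                         R \<in> carrier_mat (n - r) (p - r) \<and> op_norm R \<le> 1} V \<and>
         rel_interior (subdifferential nuclear_norm X) =
           sandwich U {of_mat (four_block_mat (1\<^sub>m r) (0\<^sub>m r (p - r)) (0\<^sub>m (n - r) r) R) | R.
                         R \<in> carrier_mat (n - r) (p - r) \<and> op_norm R < 1} V \<and>
         par (subdifferential nuclear_norm X) =
           sandwich U {of_mat (four_block_mat (0\<^sub>m r r) (0\<^sub>m r (p - r)) (0\<^sub>m (n - r) r) R) | R.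
                         R \<in> carrier_mat (n - r) (p - r)} V"
proof -
  have le: "CARD('p) \<le> CARD('n)" using n p np by simp
  define e :: "'p \<Rightarrow> 'n" where "e = embed_index"
  define t :: "'p \<Rightarrow> real" where "t = (\<lambda>j. singular_values (to_mat X) ! index_pos j)"
  define J :: "'p set" where "J = {j. index_pos j < r}"
  define E where "E = unit_diag e J"
  let ?C = "corner (e ` J) J"
  let ?B = "{K \<in> ?C. onorm ((*v) K) \<le> 1}"
  let ?zero = "\<lambda>R. of_mat (four_block_mat (0\<^sub>m r r) (0\<^sub>m r (p - r)) (0\<^sub>m (n - r) r) R) :: real^('p::{finite,linorder})^('n::{finite,linorder})"
  let ?one = "\<lambda>R. of_mat (four_block_mat (1\<^sub>m r) (0\<^sub>m r (p - r)) (0\<^sub>m (n - r) r) R) :: real^('p::{finite,linorder})^('n::{finite,linorder})"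
  have e: "inj e" unfolding e_def by (rule inj_embed_index[OF le])
  have t: "0 \<le> t j" for j
    unfolding t_def
    by (rule singular_values_nonneg[of _ X]) (simp add: length_singular_values index_pos_less)
  have X: "X = U ** gen_diag e t ** transp V"
    using svd by (simp add: n p of_mat_rect_diag[OF le] e_def t_def)
  have rank: "r = card {j. t j \<noteq> 0}"
    unfolding r by (subst X) (simp add: rank_orthogonal_mult U V rank_gen_diag[OF e])
  have "index_pos j < r \<longleftrightarrow> t j \<noteq> 0" for j
    unfolding rank t_def by (rule singular_value_nonzero_iff[symmetric])
  then have J: "J = {j. t j \<noteq> 0}"
    by (simp add: J_def)
  have rp: "r \<le> CARD('p)"
    unfolding r using rank_bound[of X] by simp
  have zero: "?zero ` carrier_mat (n - r) (p - r) = ?C"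
    using corner_eq_of_mat_block[OF le rp] by (simp add: n p e_def J_def)
  have one: "?one R = E + ?zero R" if "R \<in> carrier_mat (n - r) (p - r)" for R
    using of_mat_block_one[OF le rp] that by (simp add: n p e_def J_def E_def)
  have norm: "op_norm R = onorm ((*v) (?zero R))" if "R \<in> carrier_mat (n - r) (p - r)" for R
    using op_norm_eq_onorm[OF _ rp le] that by (simp add: n p)
  \<comment> \<open>Keeping the predicate \<open>P\<close> general serves the closed ball of (a) and
    the open ball of (b) at once.\<close>
  have blocks: "{?one R | R. R \<in> carrier_mat (n - r) (p - r) \<and> P (op_norm R)} =
      (+) E ` {K \<in> ?C. P (onorm ((*v) K))}" for P
    unfolding zero[symmetric] using one norm by force
  have a: "subdifferential nuclear_norm X = sandwich U ((+) E ` ?B) V"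
    unfolding E_def by (subst X) (rule subdifferential_nuclear_norm[OF U V e t J])
  have b: "rel_interior (subdifferential nuclear_norm X) =
      sandwich U ((+) E ` {K \<in> ?C. onorm ((*v) K) < 1}) V"
    by (simp add: a rel_interior_sandwich[OF U V] rel_interior_translation rel_interior_corner_ball)
  have "0 \<in> ?B" using subspace_0[OF subspace_corner] by simp
  \<comment> \<open>The subgradient with \<open>R = 0\<close> is the base point; subtracting it
    removes the translation by \<open>E\<close>.\<close>
  then have "U ** E ** transp V \<in> subdifferential nuclear_norm X"
    unfolding a sandwich_eq_image by (intro imageI image_eqI[of _ _ 0]) auto
  then have "par (subdifferential nuclear_norm X) =
      (\<lambda>Y. Y - U ** E ** transp V) ` sandwich U ((+) E ` ?C) V"
    by (simp add: par_eq a affine_hull_sandwich affine_hull_translation affine_hull_corner_ball)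
  also have "\<dots> = sandwich U ?C V"
    using linear_diff[OF linear_sandwich[of U "transp V"], symmetric]
    by (simp add: sandwich_eq_image image_image)
  also have "?C = {?zero R | R. R \<in> carrier_mat (n - r) (p - r)}"
    unfolding zero[symmetric] by auto
  finally show ?thesis
    using a b blocks[of "\<lambda>c. c \<le> 1"] blocks[of "\<lambda>c. c < 1"] by simp
qed

end
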